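(* Let $((x^k,y^k))_{k\ge0}$ and $(z^j)_{j\ge0}$ be generated by relaxed ADMM (described in the context) with $(\lambda_j)_{j\ge0}\subseteq(0,1]$ and $\gamma>0$. Let $z^\ast$ be a fixed point of $T_{\mathrm{PRS}}=\mathbf{refl}_{\gamma d_f}\circ\mathbf{refl}_{\gamma d_g}$, let $w^\ast=\mathbf{prox}_{\gamma d_g}(z^\ast)$, and let $(x^\ast,y^\ast)$ be an associated primal solution. Define the ergodic primal iterates $\overline{x}^k=\frac{1}{\Lambda_k}\sum_{i=0}^k\lambda_ix^i$ and $\overline{y}^k=\frac1{\Lambda_k}\sum_{i=0}^k\lambda_iy^i$, where $\Lambda_k=\sum_{i=0}^k\lambda_i$. Then for all $k\ge0$, $$-\frac{2\|w^\ast\|\|z^0-z^\ast\|}{\gamma\Lambda_k}\le f(\overline{x}^k)+g(\overline{y}^k)-f(x^\ast)-g(y^\ast)\le\frac{\|z^0-(z^\ast-w^\ast)\|^2}{4\gamma\Lambda_k}.$$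
   Context: Setting: $\mathcal{H}_1,\mathcal{H}_2,\mathcal{G}$ are Hilbert spaces, $f:\mathcal{H}_1\to(-\infty,\infty]$ and $g:\mathcal{H}_2\to(-\infty,\infty]$ are closed, proper, convex, $A:\mathcal{H}_1\to\mathcal{G}$ and $B:\mathcal{H}_2\to\mathcal{G}$ are bounded linear, $b\in\mathcal{G}$; the problem is to minimize $f(x)+g(y)$ subject to $Ax+By=b$. Put $d_f(w):=f^\ast(A^\ast w)$ and $d_g(w):=g^\ast(B^\ast w)-\langle w,b\rangle$ on $\mathcal{G}$, where $f^\ast,g^\ast$ are convex conjugates and $A^\ast,B^\ast$ adjoints. Standing assumptions: $\operatorname{zer}(\partial d_f+\partial d_g)\ne\emptyset$, $\partial d_f=A\circ\partial f^\ast\circ A^\ast$, and $\partial d_g=B\circ\partial g^\ast\circ B^\ast-b$. $\mathbf{prox}_{\gamma h}(w):=\arg\min_vh(v)+\frac1{2\gamma}\|v-w\|^2$, $\mathbf{refl}_{\gamma h}:=2\mathbf{prox}_{\gamma h}-I$. Relaxed ADMM: with $\mathcal{L}_\gamma(x,y;w):=f(x)+g(y)-\langle w,Ax+By-b\rangle+\frac\gamma2\|Ax+By-b\|^2$, start from $w^{-1}\in\mathcal{G}$, $x^{-1}=0$, $y^{-1}=0$, $\lambda_{-1}=1/2$, and for $k=-1,0,1,\dots$ let $y^{k+1}\in\arg\min_y\mathcal{L}_\gamma(x^k,y;w^k)+\gamma(2\lambda_k-1)\langle By,Ax^k+By^k-b\rangle$; $w^{k+1}=w^k-\gamma(Ax^k+By^{k+1}-b)-\gamma(2\lambda_k-1)(Ax^k+By^k-b)$;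 $x^{k+1}\in\arg\min_x\mathcal{L}_\gamma(x,y^{k+1};w^{k+1})$. The associated sequence $(z^j)_{j\ge0}\subseteq\mathcal{G}$ is the relaxed Peaceman-Rachford sequence on the dual: $z^0:=w^{-1}$ and $z^{k+1}=(1-\lambda_k)z^k+\lambda_kT_{\mathrm{PRS}}(z^k)$; it satisfies $z^{k+1}-z^k=-2\gamma\lambda_k(Ax^k+By^k-b)$. An associated primal solution is a pair $(x^\ast,y^\ast)\in\mathcal{H}_1\times\mathcal{H}_2$ with $Ax^\ast+By^\ast=b$, $A^\ast w^\ast\in\partial f(x^\ast)$, $B^\ast w^\ast\in\partial g(y^\ast)$.
   Formalization: In the y-update the constant term f(x^k) is dropped from the minimized Lagrangian; this matters only at the first step x^{-1}=0 when f(0)=∞, where literally every y would be a minimizer and the claimed bound fails. *)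

theory Defs
  imports "HOL-Analysis.Analysis" "HOL-Library.Set_Algebras"
begin

definition epi :: "('a \<Rightarrow> ereal) \<Rightarrow> ('a \<times> real) set" where
  "epi f = {(x, r). f x \<le> ereal r}"

definition closed_proper_convex :: "('a::real_normed_vector \<Rightarrow> ereal) \<Rightarrow> bool" where
  "closed_proper_convex f \<longleftrightarrow>
     closed (epi f) \<and> convex (epi f) \<and> (\<forall>x. f x \<noteq> -\<infinity>) \<and> (\<exists>x. f x \<noteq> \<infinity>)"

definition convex_conjugate :: "('a::real_inner \<Rightarrow> ereal) \<Rightarrow> 'a \<Rightarrow> ereal" where
  "convex_conjugate f u = (SUP x. ereal (x \<bullet> u) - f x)"

definition subdiff :: "('a::real_inner \<Rightarrow> ereal) \<Rightarrow> 'a \<Rightarrow> 'a set" where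
  "subdiff f x = {u. \<forall>y. f y \<ge> f x + ereal ((y - x) \<bullet> u)}"

definition zer :: "('a::real_inner \<Rightarrow> 'a set) \<Rightarrow> 'a set" where
  "zer T = {w. 0 \<in> T w}"

definition prox :: "real \<Rightarrow> ('a::real_inner \<Rightarrow> ereal) \<Rightarrow> 'a \<Rightarrow> 'a" where
  "prox \<gamma> h w = arg_min (\<lambda>v. h v + ereal (1 / (2 * \<gamma>) * (norm (v - w))\<^sup>2)) (\<lambda>_. True)"

definition refl_prox :: "real \<Rightarrow> ('a::real_inner \<Rightarrow> ereal) \<Rightarrow> 'a \<Rightarrow> 'a" where
  "refl_prox \<gamma> h w = 2 *\<^sub>R prox \<gamma> h w - w"

definition T_PRS :: "real \<Rightarrow> ('a::real_inner \<Rightarrow> ereal) \<Rightarrow> ('a \<Rightarrow> ereal) \<Rightarrow> 'a \<Rightarrow> 'a" where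
  "T_PRS \<gamma> d1 d2 = refl_prox \<gamma> d1 \<circ> refl_prox \<gamma> d2"

definition dual_f ::
  "('a::real_inner \<Rightarrow> ereal) \<Rightarrow> ('a \<Rightarrow> 'g::real_inner) \<Rightarrow> 'g \<Rightarrow> ereal" where
  "dual_f f A w = convex_conjugate f (adjoint A w)"

definition dual_g ::
  "('b::real_inner \<Rightarrow> ereal) \<Rightarrow> ('b \<Rightarrow> 'g::real_inner) \<Rightarrow> 'g \<Rightarrow> 'g \<Rightarrow> ereal" where
  "dual_g g B b w = convex_conjugate g (adjoint B w) - ereal (w \<bullet> b)"

definition aug_lagrangian ::
  "('a::real_inner \<Rightarrow> ereal) \<Rightarrow> ('b::real_inner \<Rightarrow> ereal) \<Rightarrow>
   ('a \<Rightarrow> 'g::real_inner) \<Rightarrow> ('b \<Rightarrow> 'g) \<Rightarrow> 'g \<Rightarrow> real \<Rightarrow> 'a \<Rightarrow> 'b \<Rightarrow> 'g \<Rightarrow> ereal" where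
  "aug_lagrangian f g A B b \<gamma> x y w =
     f x + g y - ereal (w \<bullet> (A x + B y - b)) + ereal (\<gamma> / 2 * (norm (A x + B y - b))\<^sup>2)"

text \<open>
  One step \<open>(x, y, w) \<mapsto> (x1, y1, w1)\<close> with relaxation parameter \<open>l\<close>.
  In the minimization over \<open>y\<close> the summand \<open>f x\<close> is constant and is replaced by \<open>0\<close>:
  the iteration starts at \<open>x = 0\<close>, where \<open>f\<close> may be infinite, and then every point would
  minimize the full Lagrangian. Where \<open>f x\<close> is finite nothing changes, see the lemma below.
  In the minimization over \<open>x\<close> the summand \<open>g y1\<close> is finite because \<open>y1\<close> is a minimizer
  and \<open>g\<close> is proper.
\<close>

definition admm_step ::
  "('a::real_inner \<Rightarrow> ereal) \<Rightarrow> ('b::real_inner \<Rightarrow> ereal) \<Rightarrow>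
   ('a \<Rightarrow> 'g::real_inner) \<Rightarrow> ('b \<Rightarrow> 'g) \<Rightarrow> 'g \<Rightarrow> real \<Rightarrow> real \<Rightarrow>
   'a \<times> 'b \<times> 'g \<Rightarrow> 'a \<times> 'b \<times> 'g \<Rightarrow> bool" where
  "admm_step f g A B b \<gamma> l = (\<lambda>(x, y, w) (x1, y1, w1).
     is_arg_min (\<lambda>v. aug_lagrangian (\<lambda>_. 0) g A B b \<gamma> x v w
                     + ereal (\<gamma> * (2 * l - 1) * (B v \<bullet> (A x + B y - b)))) (\<lambda>_. True) y1 \<and>
     w1 = w - \<gamma> *\<^sub>R (A x + B y1 - b) - (\<gamma> * (2 * l - 1)) *\<^sub>R (A x + B y - b) \<and>
     is_arg_min (\<lambda>u. aug_lagrangian f g A B b \<gamma> u y1 w1) (\<lambda>_. True) x1)"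

lemma is_arg_min_aug_lagrangian_finite:
  assumes "\<bar>f x\<bar> \<noteq> \<infinity>"
  shows "is_arg_min (\<lambda>v. aug_lagrangian f g A B b \<gamma> x v w + ereal (c v)) (\<lambda>_. True) u \<longleftrightarrow>
         is_arg_min (\<lambda>v. aug_lagrangian (\<lambda>_. 0) g A B b \<gamma> x v w + ereal (c v)) (\<lambda>_. True) u"
proof -
  obtain r where r: "f x = ereal r"
    using assms by auto
  have shift: "aug_lagrangian f g A B b \<gamma> x v w + ereal (c v)
      = ereal r + (aug_lagrangian (\<lambda>_. 0) g A B b \<gamma> x v w + ereal (c v))" for v
    by (cases "g v") (auto simp: aug_lagrangian_def r)
  have less: "ereal r + p < ereal r + q \<longleftrightarrow> p < q" for p q :: ereal
    by (cases p; cases q) auto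
  show ?thesis
    unfolding is_arg_min_def shift less ..
qed

text \<open>
  The starting point has index \<open>-1\<close>: \<open>w_init\<close> is the multiplier there, the primal variables
  are \<open>0\<close>, and the relaxation parameter is \<open>1/2\<close>. The sequences contain the indices from \<open>0\<close> on.
\<close>

definition relaxed_admm ::
  "('a::real_inner \<Rightarrow> ereal) \<Rightarrow> ('b::real_inner \<Rightarrow> ereal) \<Rightarrow>
   ('a \<Rightarrow> 'g::real_inner) \<Rightarrow> ('b \<Rightarrow> 'g) \<Rightarrow> 'g \<Rightarrow> real \<Rightarrow> (nat \<Rightarrow> real) \<Rightarrow> 'g \<Rightarrow>
   (nat \<Rightarrow> 'a) \<Rightarrow> (nat \<Rightarrow> 'b) \<Rightarrow> (nat \<Rightarrow> 'g) \<Rightarrow> bool" where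
  "relaxed_admm f g A B b \<gamma> lam w_init x y w \<longleftrightarrow>
     admm_step f g A B b \<gamma> (1 / 2) (0, 0, w_init) (x 0, y 0, w 0) \<and>
     (\<forall>k. admm_step f g A B b \<gamma> (lam k) (x k, y k, w k) (x (Suc k), y (Suc k), w (Suc k)))"

definition relaxed_prs ::
  "real \<Rightarrow> ('g::real_inner \<Rightarrow> ereal) \<Rightarrow> ('g \<Rightarrow> ereal) \<Rightarrow> (nat \<Rightarrow> real) \<Rightarrow> 'g \<Rightarrow> (nat \<Rightarrow> 'g) \<Rightarrow> bool"
  where
  "relaxed_prs \<gamma> d1 d2 lam z_init z \<longleftrightarrow>
     z 0 = z_init \<and>
     (\<forall>k. z (Suc k) = (1 - lam k) *\<^sub>R z k + lam k *\<^sub>R T_PRS \<gamma> d1 d2 (z k))"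

definition associated_primal_solution ::
  "('a::real_inner \<Rightarrow> ereal) \<Rightarrow> ('b::real_inner \<Rightarrow> ereal) \<Rightarrow>
   ('a \<Rightarrow> 'g::real_inner) \<Rightarrow> ('b \<Rightarrow> 'g) \<Rightarrow> 'g \<Rightarrow> 'g \<Rightarrow> 'a \<Rightarrow> 'b \<Rightarrow> bool" where
  "associated_primal_solution f g A B b w x y \<longleftrightarrow>
     A x + B y = b \<and> adjoint A w \<in> subdiff f x \<and> adjoint B w \<in> subdiff g y"

definition cumulative :: "(nat \<Rightarrow> real) \<Rightarrow> nat \<Rightarrow> real" where
  "cumulative lam k = (\<Sum>i=0..k. lam i)"

definition ergodic :: "(nat \<Rightarrow> real) \<Rightarrow> (nat \<Rightarrow> 'a::real_vector) \<Rightarrow> nat \<Rightarrow> 'a" where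
  "ergodic lam x k = (1 / cumulative lam k) *\<^sub>R (\<Sum>i=0..k. lam i *\<^sub>R x i)"

end

theory Submission
  imports Defs
begin

text \<open>
  The first-order conditions of the two subproblems put \<open>A\<^sup>* (w - \<gamma> r)\<close> into \<open>\<partial>f x\<close> and
  \<open>B\<^sup>* w\<close> into \<open>\<partial>g y\<close>, where \<open>r = A x + B y - b\<close>. Hence \<open>w\<close> and \<open>w - \<gamma> r\<close> are the two
  proximal points of \<open>z = w + \<gamma> (B y - b)\<close>, each relaxed step is \<open>z \<mapsto> z - 2 \<gamma> \<lambda> r\<close>, and the
  Fenchel-Young equality gives the values of the dual functions there.
  At \<open>w*\<close> the fixed point supplies the subgradients \<open>p\<close> of \<open>d_g\<close> and \<open>- p\<close> of \<open>d_f\<close>, with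
  \<open>\<gamma> p = z* - w*\<close>. The point \<open>B y* - b\<close> is also a subgradient of \<open>d_g\<close> but may differ from
  \<open>p\<close>; only the optimal value \<open>f x* + g y* = - d_f w* - d_g w*\<close> matters, so the gap is compared
  on the dual side. This bounds the gap of an iterate by \<open>(z - \<gamma> p) \<bullet> r - \<gamma> |r|^2\<close>, and summing
  over the steps telescopes the squared distances to \<open>z* - w*\<close>; convexity passes to the averages.
  The lower bound is the subgradient inequality at \<open>(x*, y*)\<close>: the residual of the averages is
  \<open>(z 0 - z (k + 1)) / (2 \<gamma> \<Lambda>)\<close>, which the Fejer monotonicity of \<open>z\<close> towards \<open>z*\<close> controls.
\<close>

section \<open>First-order optimality conditions\<close>

lemma norm_add_scaleR_squared:
  fixes a d :: "'a::real_inner"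
  shows "(norm (a + t *\<^sub>R d))\<^sup>2 = (norm a)\<^sup>2 + 2 * t * (a \<bullet> d) + t\<^sup>2 * (norm d)\<^sup>2"
  unfolding power2_norm_eq_inner
  by (simp add: inner_add_left inner_add_right inner_commute power2_eq_square algebra_simps)

lemma subdiffD: "p \<in> subdiff h x \<Longrightarrow> h x + ereal ((v - x) \<bullet> p) \<le> h v"
  unfolding subdiff_def by blast

text \<open>Here \<open>p\<close> acts as minus the gradient of \<open>q\<close> at
  \<open>u\<close>. Comparing \<open>u\<close> with a point at fraction \<open>t\<close> of the
  segment towards \<open>v\<close>, convexity of \<open>h\<close> and the expansion of
  \<open>q\<close> leave an error \<open>t * C d\<close> after division by \<open>t\<close>, which
  vanishes as \<open>t\<close> tends to 0. The constant may depend on the direction, so any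
  quadratic \<open>q\<close> qualifies.\<close>

lemma is_arg_min_imp_subdiff:
  fixes h :: "'a::real_inner \<Rightarrow> ereal"
  assumes h: "closed_proper_convex h"
    and min: "is_arg_min (\<lambda>v. h v + ereal (q v)) (\<lambda>_. True) u"
    and q: "\<And>d t. 0 < t \<Longrightarrow> t \<le> 1 \<Longrightarrow> q (u + t *\<^sub>R d) \<le> q u - t * (p \<bullet> d) + t\<^sup>2 * C d"
  shows "\<exists>r. h u = ereal r" and "p \<in> subdiff h u"
proof -
  have le: "h u + ereal (q u) \<le> h v + ereal (q v)" for v
    using min by (auto simp: is_arg_min_linorder)
  obtain v0 where v0: "h v0 \<noteq> \<infinity>" and nm: "\<And>v. h v \<noteq> -\<infinity>" and conv: "convex (epi h)"
    using h by (auto simp: closed_proper_convex_def)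
  obtain r where r: "h u = ereal r"
    using le[of v0] v0 nm[of v0] nm[of u] by (cases "h u"; cases "h v0") auto
  then show "\<exists>r. h u = ereal r" by blast
  have "h u + ereal ((v - u) \<bullet> p) \<le> h v" for v
  proof (cases "h v")
    case (real s)
    define d where "d = v - u"
    have slope: "p \<bullet> d - (s - r) \<le> t * C d" if t: "0 < t" "t \<le> 1" for t
    proof -
      have "(1 - t) *\<^sub>R (u, r) + t *\<^sub>R (v, s) \<in> epi h"
        using t r real by (intro convexD[OF conv]) (auto simp: epi_def)
      moreover have "(1 - t) *\<^sub>R (u, r) + t *\<^sub>R (v, s) = (u + t *\<^sub>R d, r + t * (s - r))"
        by (simp add: d_def algebra_simps)
      ultimately have "h (u + t *\<^sub>R d) \<le> ereal (r + t * (s - r))"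
        by (simp add: epi_def)
      moreover have "ereal (r + q u) \<le> h (u + t *\<^sub>R d) + ereal (q (u + t *\<^sub>R d))"
        using le[of "u + t *\<^sub>R d"] r by simp
      ultimately have "r + q u \<le> r + t * (s - r) + q (u + t *\<^sub>R d)"
        by (cases "h (u + t *\<^sub>R d)") auto
      with q[OF t, of d] have "t * (p \<bullet> d - (s - r)) \<le> t * (t * C d)"
        by (simp add: algebra_simps power2_eq_square)
      with t show ?thesis by simp
    qed
    have "p \<bullet> d - (s - r) \<le> 0"
    proof (rule tendsto_lowerbound)
      show "((\<lambda>t. t * C d) \<longlongrightarrow> 0) (at_right 0)"
        by (auto intro!: tendsto_eq_intros)
      show "\<forall>\<^sub>F t in at_right 0. p \<bullet> d - (s - r) \<le> t * C d"
        using slope by (intro eventually_at_rightI[of 0 1]) auto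
    qed simp
    then show ?thesis
      using r real by (simp add: d_def inner_commute)
  qed (use nm in auto)
  then show "p \<in> subdiff h u" by (simp add: subdiff_def)
qed

section \<open>Proximal points, and the Riesz representation derived from them\<close>

text \<open>Strong convexity of the squared norm makes a minimizing sequence Cauchy; the closed
  epigraph then contains the limit. The lower bound on \<open>h\<close> keeps the infimum
  finite.\<close>

lemma ex_is_arg_min_prox:
  fixes h :: "'a::{real_inner, complete_space} \<Rightarrow> ereal"
  assumes h: "closed_proper_convex h" and "\<gamma> > 0"
    and minorant: "\<And>v. h v \<ge> ereal (- c - K * norm v)"
  shows "\<exists>u. is_arg_min (\<lambda>v. h v + ereal (1 / (2 * \<gamma>) * (norm (v - z))\<^sup>2)) (\<lambda>_. True) u"
proof -
  define q where "q v = 1 / (2 * \<gamma>) * (norm (v - z))\<^sup>2" for v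
  \<comment> \<open>Taking the infimum over points of the epigraph keeps all values real.\<close>
  define R where "R = (\<lambda>(v, r). r + q v) ` epi h"
  define m where "m = Inf R"
  obtain v0 where v0: "h v0 \<noteq> \<infinity>" and nm: "\<And>v. h v \<noteq> -\<infinity>"
    and conv: "convex (epi h)" and clo: "closed (epi h)"
    using h by (auto simp: closed_proper_convex_def)
  have ne: "R \<noteq> {}"
    using v0 nm[of v0] by (cases "h v0") (auto simp: R_def epi_def intro: eq_refl)
  have bdd: "bdd_below R"
  proof (rule bdd_belowI)
    fix a assume "a \<in> R"
    then obtain v r where vr: "h v \<le> ereal r" "a = r + q v" by (auto simp: R_def epi_def)
    have r: "- c - K * norm v \<le> r"
      using minorant[of v] vr(1) by (metis ereal_less_eq(3) order_trans)
    have nv: "norm v \<le> norm (v - z) + norm z"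
      using norm_triangle_ineq[of "v - z" z] by simp
    have "K * norm v \<le> \<bar>K\<bar> * norm v"
      by (intro mult_right_mono) auto
    also have "\<dots> \<le> \<bar>K\<bar> * norm (v - z) + \<bar>K\<bar> * norm z"
      using mult_left_mono[OF nv, of "\<bar>K\<bar>"] by (simp add: algebra_simps)
    finally have K: "K * norm v \<le> \<bar>K\<bar> * norm (v - z) + \<bar>K\<bar> * norm z" .
    \<comment> \<open>Completing the square: the quadratic absorbs the linear decrease of slope
      \<open>\<bar>K\<bar>\<close> at the cost of the constant
      \<open>\<gamma> * K\<^sup>2 / 2\<close>.\<close>
    have "0 \<le> 1 / (2 * \<gamma>) * (norm (v - z) - \<gamma> * \<bar>K\<bar>)\<^sup>2"
      using \<open>\<gamma> > 0\<close> by simp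
    also have "\<dots> = q v - \<bar>K\<bar> * norm (v - z) + \<gamma> * K\<^sup>2 / 2"
      using \<open>\<gamma> > 0\<close> unfolding q_def power2_diff
      by (simp add: field_simps power2_eq_square)
    finally show "- c - \<bar>K\<bar> * norm z - \<gamma> * K\<^sup>2 / 2 \<le> a"
      using r K vr(2) by linarith
  qed
  have lower: "m \<le> r + q v" if "h v \<le> ereal r" for v r
    using bdd that by (auto simp: m_def R_def epi_def intro!: cInf_lower)
  have "\<exists>v r. h v \<le> ereal r \<and> r + q v < m + 1 / real (Suc n)" for n
  proof -
    have "Inf R < m + 1 / real (Suc n)" by (simp add: m_def)
    then obtain a where "a \<in> R" "a < m + 1 / real (Suc n)"
      using cInf_lessD[OF ne] by blast
    then show ?thesis by (auto simp: R_def epi_def)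
  qed
  then obtain v r where vr: "\<And>n. h (v n) \<le> ereal (r n)"
      "\<And>n. r n + q (v n) < m + 1 / real (Suc n)"
    by metis
  \<comment> \<open>By the parallelogram law the midpoint of two near-minimizers gains
    \<open>(norm (v i - v j))\<^sup>2 / (8 * \<gamma>)\<close> over their average, yet its value is
    at least \<open>m\<close>.\<close>
  have dist: "(norm (v i - v j))\<^sup>2 \<le> 4 * \<gamma> * (1 / real (Suc i) + 1 / real (Suc j))" for i j
  proof -
    have "(1/2) *\<^sub>R (v i, r i) + (1/2) *\<^sub>R (v j, r j) \<in> epi h"
      using vr(1) by (intro convexD[OF conv]) (auto simp: epi_def)
    then have "h ((1/2) *\<^sub>R (v i + v j)) \<le> ereal ((r i + r j) / 2)"
      by (simp add: epi_def scaleR_add_right add_divide_distrib)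
    from lower[OF this] have 1: "m \<le> (r i + r j) / 2 + q ((1/2) *\<^sub>R (v i + v j))" .
    have "(norm ((1/2) *\<^sub>R (v i + v j) - z))\<^sup>2
        = (norm (v i - z))\<^sup>2 / 2 + (norm (v j - z))\<^sup>2 / 2 - (norm (v i - v j))\<^sup>2 / 4"
    proof -
      define a d where "a = v i - z" and "d = v j - v i"
      have e: "(1/2) *\<^sub>R (v i + v j) - z = a + (1/2) *\<^sub>R d"
        using scaleR_half_double[of "v i"] by (simp add: a_def d_def algebra_simps)
      have e': "v j - z = a + 1 *\<^sub>R d" by (simp add: a_def d_def)
      have e'': "norm (v i - v j) = norm d" by (simp add: d_def norm_minus_commute)
      show ?thesis
        unfolding e e' e'' norm_add_scaleR_squared
        by (simp add: a_def power2_eq_square add_divide_distrib)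
    qed
    then have 2: "q ((1/2) *\<^sub>R (v i + v j))
        = (q (v i) + q (v j)) / 2 - (norm (v i - v j))\<^sup>2 / (8 * \<gamma>)"
      unfolding q_def by (simp only: ring_distribs) (simp add: field_simps)
    have "(norm (v i - v j))\<^sup>2 / (8 * \<gamma>) \<le> (1 / real (Suc i) + 1 / real (Suc j)) / 2"
      using 1 2 vr(2)[of i] vr(2)[of j] by argo
    then have "(norm (v i - v j))\<^sup>2 \<le> (1 / real (Suc i) + 1 / real (Suc j)) / 2 * (8 * \<gamma>)"
      using \<open>\<gamma> > 0\<close> by (simp only: pos_divide_le_eq mult_pos_pos zero_less_numeral)
    also have "\<dots> = 4 * \<gamma> * (1 / real (Suc i) + 1 / real (Suc j))" by simp
    finally show ?thesis .
  qed
  have "Cauchy v"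
  proof (rule metric_CauchyI)
    fix e :: real assume "e > 0"
    obtain N where N: "1 / real (Suc N) < e\<^sup>2 / (8 * \<gamma>)"
      using \<open>e > 0\<close> \<open>\<gamma> > 0\<close> reals_Archimedean[of "e\<^sup>2 / (8 * \<gamma>)"]
      by (auto simp: inverse_eq_divide)
    have half: "e\<^sup>2 / (8 * \<gamma>) + e\<^sup>2 / (8 * \<gamma>) = e\<^sup>2 / (4 * \<gamma>)"
      using \<open>\<gamma> > 0\<close> by (simp add: field_simps)
    have "dist (v i) (v j) < e" if "i \<ge> N" "j \<ge> N" for i j
    proof -
      have "1 / real (Suc i) \<le> 1 / real (Suc N)" "1 / real (Suc j) \<le> 1 / real (Suc N)"
        using that by (auto simp: frac_le)
      then have "1 / real (Suc i) + 1 / real (Suc j) < e\<^sup>2 / (4 * \<gamma>)"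
        using N \<open>\<gamma> > 0\<close> half by linarith
      then have "4 * \<gamma> * (1 / real (Suc i) + 1 / real (Suc j)) < 4 * \<gamma> * (e\<^sup>2 / (4 * \<gamma>))"
        using \<open>\<gamma> > 0\<close> by (intro mult_strict_left_mono) auto
      also have "\<dots> = e\<^sup>2" using \<open>\<gamma> > 0\<close> by simp
      finally have "(norm (v i - v j))\<^sup>2 < e\<^sup>2"
        using dist[of i j] by linarith
      then show ?thesis
        using \<open>e > 0\<close> by (simp add: dist_norm power2_less_imp_less)
    qed
    then show "\<exists>M. \<forall>i\<ge>M. \<forall>j\<ge>M. dist (v i) (v j) < e" by blast
  qed
  then obtain u where u: "v \<longlonglongrightarrow> u"
    using Cauchy_convergent_iff convergent_def by blast
  have qu: "(\<lambda>n. q (v n)) \<longlonglongrightarrow> q u"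
    unfolding q_def by (intro tendsto_intros u)
  have "(\<lambda>n. r n + q (v n)) \<longlonglongrightarrow> m"
  proof (rule tendsto_sandwich[where f = "\<lambda>_. m"])
    show "(\<lambda>n. m + 1 / real (Suc n)) \<longlonglongrightarrow> m"
      using tendsto_add[OF tendsto_const[of m] LIMSEQ_inverse_real_of_nat]
      by (simp add: inverse_eq_divide)
    show "\<forall>\<^sub>F n in sequentially. m \<le> r n + q (v n)"
      using lower[OF vr(1)] by simp
    show "\<forall>\<^sub>F n in sequentially. r n + q (v n) \<le> m + 1 / real (Suc n)"
      using vr(2) by (simp add: less_imp_le)
  qed simp
  \<comment> \<open>The heights \<open>r n\<close> converge as well, so the limit of the pairs lies
    in the closed epigraph.\<close>
  from tendsto_diff[OF this qu] have "r \<longlonglongrightarrow> m - q u" by simp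
  with u have "(\<lambda>n. (v n, r n)) \<longlonglongrightarrow> (u, m - q u)" by (rule tendsto_Pair)
  then have "(u, m - q u) \<in> epi h"
    by (rule closed_sequentially[OF clo, rotated]) (simp add: epi_def vr(1))
  then have hu: "h u \<le> ereal (m - q u)" by (simp add: epi_def)
  have "h u + ereal (q u) \<le> h a + ereal (q a)" for a
  proof (cases "h a")
    case (real s)
    with lower[of a s] have "ereal m \<le> h a + ereal (q a)" by simp
    moreover have "h u + ereal (q u) \<le> ereal m"
      using hu by (cases "h u") auto
    ultimately show ?thesis by (rule order_trans[rotated])
  qed (use nm in auto)
  then show ?thesis by (auto simp: is_arg_min_linorder q_def)
qed

text \<open>\<open>prox\<close> is a choice operator, so existence must come first; the inclusion is
  then the first-order condition for the exactly expanded square.\<close>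

lemma subdiff_prox:
  fixes h :: "'a::{real_inner, complete_space} \<Rightarrow> ereal"
  assumes h: "closed_proper_convex h" and "\<gamma> > 0"
    and minorant: "\<And>v. h v \<ge> ereal (- c - K * norm v)"
  shows "(1 / \<gamma>) *\<^sub>R (z - prox \<gamma> h z) \<in> subdiff h (prox \<gamma> h z)"
proof -
  define u where "u = prox \<gamma> h z"
  have min: "is_arg_min (\<lambda>v. h v + ereal (1 / (2 * \<gamma>) * (norm (v - z))\<^sup>2)) (\<lambda>_. True) u"
    using ex_is_arg_min_prox[OF assms, of z] unfolding u_def prox_def arg_min_def
    by (rule someI_ex)
  have q: "1 / (2 * \<gamma>) * (norm (u + t *\<^sub>R d - z))\<^sup>2
      \<le> 1 / (2 * \<gamma>) * (norm (u - z))\<^sup>2 - t * (((1 / \<gamma>) *\<^sub>R (z - u)) \<bullet> d)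
        + t\<^sup>2 * ((norm d)\<^sup>2 / (2 * \<gamma>))" for t d
  proof -
    have e: "u + t *\<^sub>R d - z = (u - z) + t *\<^sub>R d" by simp
    show ?thesis
      using \<open>\<gamma> > 0\<close> unfolding e norm_add_scaleR_squared
      by (simp add: inner_diff_left field_simps)
  qed
  show "(1 / \<gamma>) *\<^sub>R (z - u) \<in> subdiff h u"
    using is_arg_min_imp_subdiff(2)[OF h min q] by blast
qed

text \<open>The subgradient inequality plus the expanded square gives quadratic growth away from
  \<open>u\<close>. Hence \<open>u\<close> is the only minimizer, which pins down the choice made by
  \<open>prox\<close>.\<close>

lemma prox_eqI:
  assumes "\<gamma> > 0" and fin: "h u = ereal r" and sub: "p \<in> subdiff h u" and z: "z = u + \<gamma> *\<^sub>R p"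
  shows "prox \<gamma> h z = u"
proof -
  let ?\<phi> = "\<lambda>v. h v + ereal (1 / (2 * \<gamma>) * (norm (v - z))\<^sup>2)"
  have growth: "?\<phi> u + ereal (1 / (2 * \<gamma>) * (norm (v - u))\<^sup>2) \<le> ?\<phi> v" for v
  proof -
    have "h u + ereal ((v - u) \<bullet> p) \<le> h v" using sub by (rule subdiffD)
    moreover have "(v - u) \<bullet> p + 1 / (2 * \<gamma>) * (norm (v - z))\<^sup>2
        = 1 / (2 * \<gamma>) * (norm (u - z))\<^sup>2 + 1 / (2 * \<gamma>) * (norm (v - u))\<^sup>2"
      using \<open>\<gamma> > 0\<close> unfolding power2_norm_eq_inner z
      by (simp add: inner_add_left inner_add_right inner_diff_left inner_diff_right
          inner_commute field_simps power2_eq_square)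
    ultimately show ?thesis using fin by (cases "h v") auto
  qed
  have "is_arg_min ?\<phi> (\<lambda>_. True) v \<longleftrightarrow> v = u" for v
  proof
    assume "v = u"
    moreover have "?\<phi> u \<le> ?\<phi> a" for a
    proof -
      have "?\<phi> u \<le> ?\<phi> u + ereal (1 / (2 * \<gamma>) * (norm (a - u))\<^sup>2)"
        using fin \<open>\<gamma> > 0\<close> by simp
      with growth[of a] show ?thesis by (rule order_trans[rotated])
    qed
    ultimately show "is_arg_min ?\<phi> (\<lambda>_. True) v" by (simp add: is_arg_min_linorder)
  next
    assume "is_arg_min ?\<phi> (\<lambda>_. True) v"
    then have "?\<phi> v \<le> ?\<phi> u" by (simp add: is_arg_min_linorder)
    with growth[of v] have "?\<phi> u + ereal (1 / (2 * \<gamma>) * (norm (v - u))\<^sup>2) \<le> ?\<phi> u"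
      by (rule order_trans)
    then have "1 / (2 * \<gamma>) * (norm (v - u))\<^sup>2 \<le> 0" using fin by simp
    then show "v = u" using \<open>\<gamma> > 0\<close> by (simp add: divide_le_0_iff)
  qed
  then show ?thesis by (simp add: prox_def arg_min_def)
qed

text \<open>The representing vector is read off the first-order condition for the proximal point of \<open>- L\<close>
  at the origin.\<close>

lemma riesz_representation:
  fixes L :: "'a::{real_inner, complete_space} \<Rightarrow> real"
  assumes "bounded_linear L"
  shows "\<exists>u. \<forall>v. L v = v \<bullet> u"
proof -
  interpret bounded_linear L by fact
  obtain K where K: "\<And>v. norm (L v) \<le> norm v * K" using bounded by blast
  define h where "h v = ereal (- L v)" for v
  have e: "epi h = {(v, r). - L v \<le> r}" by (auto simp: epi_def h_def)
  have cl: "closed (epi h)"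
    unfolding e case_prod_beta
    by (intro closed_Collect_le continuous_intros continuous_on)
  have "linear (\<lambda>p. snd p + L (fst p))"
    by (rule linearI) (simp_all add: add scale algebra_simps)
  then have "convex ((\<lambda>p. snd p + L (fst p)) -` {0..})"
    by (rule convex_linear_vimage) simp
  also have "(\<lambda>p. snd p + L (fst p)) -` {0..} = epi h"
    by (auto simp: e)
  finally have cv: "convex (epi h)" .
  have cpc: "closed_proper_convex h"
    using cl cv by (auto simp: closed_proper_convex_def h_def)
  have "- 0 - K * norm v \<le> - L v" for v
    using K[of v] by (simp add: mult.commute)
  then have minorant: "h v \<ge> ereal (- 0 - K * norm v)" for v
    unfolding h_def ereal_less_eq .
  define u where "u = prox 1 h 0"
  have sub: "- u \<in> subdiff h u"
    using subdiff_prox[OF cpc zero_less_one minorant, of 0] by (simp add: u_def)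
  have ge: "- L u - (a - u) \<bullet> u \<le> - L a" for a
    using subdiffD[OF sub, of a] by (simp add: h_def)
  \<comment> \<open>Opposite directions \<open>v\<close> and \<open>- v\<close> give the two
    inequalities.\<close>
  have "L v = v \<bullet> u" for v
    using ge[of "u + v"] ge[of "u - v"] by (simp add: add diff)
  then show ?thesis by blast
qed

section \<open>Adjoints and the dual functions\<close>

text \<open>\<open>adjoint\<close> is also defined by choice; the Riesz representation of each
  functional \<open>M x \<bullet> v\<close> in \<open>x\<close> supplies a witness.\<close>

lemma inner_adjoint:
  fixes M :: "'a::{real_inner, complete_space} \<Rightarrow> 'g::real_inner"
  assumes "bounded_linear M"
  shows "x \<bullet> adjoint M v = M x \<bullet> v"
proof -
  have "\<exists>u. \<forall>x. M x \<bullet> v = x \<bullet> u" for v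
    using riesz_representation[OF bounded_linear_inner_left_comp[OF assms]] .
  then obtain M' where "\<And>x v. M x \<bullet> v = x \<bullet> M' v" by metis
  then have "\<exists>M'. \<forall>x v. M x \<bullet> v = x \<bullet> M' v" by blast
  from someI_ex[OF this] have "\<forall>x v. M x \<bullet> v = x \<bullet> adjoint M v"
    unfolding adjoint_def .
  from this[rule_format, of x v] show ?thesis by (rule sym)
qed

text \<open>Lets every result on \<open>dual_g\<close> serve \<open>dual_f\<close> with shift
  0.\<close>

lemma dual_f_eq_dual_g: "dual_f h M = dual_g h M 0"
  by (auto simp: dual_f_def dual_g_def)

text \<open>This describes the epigraph by one affine condition per point \<open>x\<close>, with a
  real left-hand side that avoids undetermined differences of infinities.\<close>

lemma dual_g_le_iff:
  fixes M :: "'a::{real_inner, complete_space} \<Rightarrow> 'g::real_inner"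
  assumes "bounded_linear M"
  shows "dual_g h M c v \<le> ereal r \<longleftrightarrow> (\<forall>x. ereal ((M x - c) \<bullet> v - r) \<le> h x)"
proof -
  have "dual_g h M c v \<le> ereal r \<longleftrightarrow> convex_conjugate h (adjoint M v) \<le> ereal (r + v \<bullet> c)"
    by (cases "convex_conjugate h (adjoint M v)") (auto simp: dual_g_def algebra_simps)
  also have "\<dots> \<longleftrightarrow> (\<forall>x. ereal (M x \<bullet> v) - h x \<le> ereal (r + v \<bullet> c))"
    by (simp add: convex_conjugate_def SUP_le_iff inner_adjoint[OF assms])
  also have "\<dots> \<longleftrightarrow> (\<forall>x. ereal ((M x - c) \<bullet> v - r) \<le> h x)"
  proof (intro all_cong1)
    fix x
    show "ereal (M x \<bullet> v) - h x \<le> ereal (r + v \<bullet> c) \<longleftrightarrow> ereal ((M x - c) \<bullet> v - r) \<le> h x"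
      by (cases "h x") (auto simp: inner_diff_left inner_commute[of v c] algebra_simps)
  qed
  finally show ?thesis .
qed

lemma dual_g_ge:
  fixes M :: "'a::{real_inner, complete_space} \<Rightarrow> 'g::real_inner"
  assumes "bounded_linear M" and "h x = ereal s"
  shows "ereal ((M x - c) \<bullet> v - s) \<le> dual_g h M c v"
proof -
  have ub: "(M x - c) \<bullet> v - s \<le> r" if "dual_g h M c v \<le> ereal r" for r
    using that assms(2) unfolding dual_g_le_iff[OF assms(1)] by (auto dest: spec[of _ x])
  show ?thesis
  proof (cases "dual_g h M c v")
    case (real r)
    with ub[of r] show ?thesis by simp
  next
    case MInf
    \<comment> \<open>At value minus infinity every real would be an upper bound, including one just
      below the claimed lower bound.\<close>
    with ub[of "(M x - c) \<bullet> v - s - 1"] show ?thesis by simp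
  qed simp
qed

text \<open>Equality in Fenchel-Young. The affine minorant of the dual function attached to
  \<open>x\<close> thus touches it at \<open>u\<close>, so its slope \<open>M x - c\<close> is a
  subgradient there.\<close>

lemma dual_g_eq:
  fixes M :: "'a::{real_inner, complete_space} \<Rightarrow> 'g::real_inner"
  assumes "bounded_linear M" and "h x = ereal s" and sub: "adjoint M u \<in> subdiff h x"
  shows "dual_g h M c u = ereal ((M x - c) \<bullet> u - s)"
    and "M x - c \<in> subdiff (dual_g h M c) u"
proof -
  have "ereal ((M a - c) \<bullet> u - ((M x - c) \<bullet> u - s)) \<le> h a" for a
  proof -
    have "h x + ereal ((a - x) \<bullet> adjoint M u) \<le> h a" using sub by (rule subdiffD)
    then show ?thesis
      by (simp add: assms(2) inner_diff_left inner_adjoint[OF assms(1)]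
          linear_diff[OF bounded_linear.linear[OF assms(1)]] algebra_simps)
  qed
  then have "dual_g h M c u \<le> ereal ((M x - c) \<bullet> u - s)"
    by (simp add: dual_g_le_iff[OF assms(1)])
  then show eq: "dual_g h M c u = ereal ((M x - c) \<bullet> u - s)"
    using dual_g_ge[where h = h and c = c, OF assms(1,2)] by (rule antisym)
  show "M x - c \<in> subdiff (dual_g h M c) u"
    unfolding subdiff_def eq
    using dual_g_ge[where h = h and c = c, OF assms(1,2)]
    by (auto simp: inner_diff_left inner_diff_right inner_commute algebra_simps)
qed

text \<open>The epigraph is an intersection of closed half-spaces, up to trivial members where
  \<open>h\<close> is infinite. The finite value at \<open>x\<close> excludes minus infinity;
  \<open>u\<close> excludes the constant infinity.\<close>

lemma closed_proper_convex_dual_g: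
  fixes M :: "'a::{real_inner, complete_space} \<Rightarrow> 'g::real_inner"
  assumes M: "bounded_linear M" and "h x = ereal s" and "dual_g h M c u \<noteq> \<infinity>"
  shows "closed_proper_convex (dual_g h M c)"
proof -
  define H where "H x = {(v, r). ereal ((M x - c) \<bullet> v - r) \<le> h x}" for x
  have epi: "epi (dual_g h M c) = (\<Inter>x. H x)"
    by (auto simp: epi_def H_def dual_g_le_iff[OF M])
  have H: "H x = {p. (M x - c) \<bullet> fst p - snd p \<le> t}" if "h x = ereal t" for x t
    using that by (auto simp: H_def)
  have "closed (H x) \<and> convex (H x)" for x
  proof (cases "h x")
    case (real t)
    have "closed {p. (M x - c) \<bullet> fst p - snd p \<le> t}"
      by (intro closed_Collect_le continuous_intros)
    moreover have "{p. (M x - c) \<bullet> fst p - snd p \<le> t} = {p. (M x - c, - 1) \<bullet> p \<le> t}"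
      by (auto simp: inner_prod_def)
    ultimately show ?thesis
      using H[OF real] by (metis convex_halfspace_le)
  qed (auto simp: H_def)
  moreover have "dual_g h M c v \<noteq> - \<infinity>" for v
    using dual_g_ge[where h = h and c = c and v = v, OF assms(1,2)] by auto
  ultimately show ?thesis
    using assms(3) unfolding closed_proper_convex_def epi
    by (auto intro: closed_INT convex_INT)
qed

lemma subdiff_prox_dual_g:
  fixes M :: "'a::{real_inner, complete_space} \<Rightarrow> 'g::{real_inner, complete_space}"
  assumes "bounded_linear M" and "h x = ereal s" and "dual_g h M c u \<noteq> \<infinity>" and "\<gamma> > 0"
  shows "(1 / \<gamma>) *\<^sub>R (z - prox \<gamma> (dual_g h M c) z)
    \<in> subdiff (dual_g h M c) (prox \<gamma> (dual_g h M c) z)"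
proof (rule subdiff_prox[OF closed_proper_convex_dual_g[where x = x and u = u] \<open>\<gamma> > 0\<close>])
  fix v
  \<comment> \<open>Cauchy-Schwarz turns the affine minorant attached to \<open>x\<close> into the
    lower bound needed for proximal points.\<close>
  have "- s - norm (M x - c) * norm v \<le> (M x - c) \<bullet> v - s"
    using Cauchy_Schwarz_ineq2[of "M x - c" v] by linarith
  then show "ereal (- s - norm (M x - c) * norm v) \<le> dual_g h M c v"
    using dual_g_ge[where h = h and c = c and v = v, OF assms(1,2)]
    by (meson ereal_less_eq(3) order_trans)
qed (use assms in auto)

lemma subdiff_finite:
  assumes "closed_proper_convex h" and "p \<in> subdiff h x"
  shows "\<exists>r. h x = ereal r"
proof -
  obtain v where "h v \<noteq> \<infinity>" and nm: "\<And>v. h v \<noteq> -\<infinity>"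
    using assms(1) by (auto simp: closed_proper_convex_def)
  moreover have "h x + ereal ((v - x) \<bullet> p) \<le> h v" using assms(2) by (rule subdiffD)
  ultimately show ?thesis using nm[of x] by (cases "h x") auto
qed

section \<open>ADMM steps as Peaceman-Rachford steps\<close>

text \<open>Each subproblem adds a quadratic to \<open>g\<close> or \<open>f\<close>. The multiplier
  update is made so that minus the gradient in \<open>y\<close>, relaxation term included, is
  exactly \<open>adjoint B w1\<close>.\<close>

lemma admm_step_subdiff:
  fixes f :: "'a::{real_inner, complete_space} \<Rightarrow> ereal"
    and g :: "'b::{real_inner, complete_space} \<Rightarrow> ereal"
    and A :: "'a \<Rightarrow> 'g::real_inner" and B :: "'b \<Rightarrow> 'g"
  assumes f: "closed_proper_convex f" and g: "closed_proper_convex g"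
    and A: "bounded_linear A" and B: "bounded_linear B"
    and step: "admm_step f g A B b \<gamma> l (x, y, w) (x1, y1, w1)"
  shows "adjoint B w1 \<in> subdiff g y1"
    and "adjoint A (w1 - \<gamma> *\<^sub>R (A x1 + B y1 - b)) \<in> subdiff f x1"
proof -
  interpret A: bounded_linear A by fact
  interpret B: bounded_linear B by fact
  define e where "e = A x + B y - b"
  have w1: "w1 = w - \<gamma> *\<^sub>R (A x + B y1 - b) - (\<gamma> * (2 * l - 1)) *\<^sub>R e"
    using step unfolding admm_step_def e_def by blast
  define q where "q v = - (w \<bullet> (A x + B v - b)) + \<gamma> / 2 * (norm (A x + B v - b))\<^sup>2
    + \<gamma> * (2 * l - 1) * (B v \<bullet> e)" for v
  have "aug_lagrangian (\<lambda>_. 0) g A B b \<gamma> x v w + ereal (\<gamma> * (2 * l - 1) * (B v \<bullet> e))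
      = g v + ereal (q v)" for v
    by (cases "g v") (auto simp: aug_lagrangian_def q_def)
  then have min: "is_arg_min (\<lambda>v. g v + ereal (q v)) (\<lambda>_. True) y1"
    using step by (simp add: admm_step_def e_def)
  have "q (y1 + t *\<^sub>R d) \<le> q y1 - t * (adjoint B w1 \<bullet> d) + t\<^sup>2 * (\<gamma> / 2 * (norm (B d))\<^sup>2)"
    for t d
  proof -
    define a where "a = A x + B y1 - b"
    have e1: "A x + B (y1 + t *\<^sub>R d) - b = a + t *\<^sub>R B d"
      by (simp add: a_def B.add B.scaleR)
    have e2: "adjoint B w1 \<bullet> d = w1 \<bullet> B d"
      by (metis B inner_adjoint inner_commute)
    show ?thesis
      unfolding q_def e1 e2 a_def[symmetric]
      unfolding w1 a_def[symmetric]
      by (simp add: norm_add_scaleR_squared inner_add_left inner_add_right inner_diff_left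
          B.add B.scaleR inner_commute[of _ e] algebra_simps)
  qed
  note opt = is_arg_min_imp_subdiff[OF g min this]
  from opt(2) show "adjoint B w1 \<in> subdiff g y1" .
  \<comment> \<open>Finiteness of \<open>g y1\<close> allows it to enter the smooth part of the
    \<open>x\<close> subproblem as a constant.\<close>
  obtain s where s: "g y1 = ereal s" using opt(1) by blast
  define q' where "q' u = s - w1 \<bullet> (A u + B y1 - b) + \<gamma> / 2 * (norm (A u + B y1 - b))\<^sup>2" for u
  have "aug_lagrangian f g A B b \<gamma> u y1 w1 = f u + ereal (q' u)" for u
    by (cases "f u") (auto simp: aug_lagrangian_def q'_def s)
  then have min': "is_arg_min (\<lambda>u. f u + ereal (q' u)) (\<lambda>_. True) x1"
    using step by (simp add: admm_step_def)
  define a where "a = A x1 + B y1 - b"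
  have "q' (x1 + t *\<^sub>R d)
      \<le> q' x1 - t * (adjoint A (w1 - \<gamma> *\<^sub>R a) \<bullet> d) + t\<^sup>2 * (\<gamma> / 2 * (norm (A d))\<^sup>2)" for t d
  proof -
    have e1: "A (x1 + t *\<^sub>R d) + B y1 - b = a + t *\<^sub>R A d"
      by (simp add: a_def A.add A.scaleR)
    have e2: "adjoint A (w1 - \<gamma> *\<^sub>R a) \<bullet> d = (w1 - \<gamma> *\<^sub>R a) \<bullet> A d"
      by (metis A inner_adjoint inner_commute)
    show ?thesis
      unfolding q'_def e1 e2 a_def[symmetric]
      by (simp add: norm_add_scaleR_squared inner_add_right inner_diff_left algebra_simps)
  qed
  from is_arg_min_imp_subdiff(2)[OF f min' this]
  show "adjoint A (w1 - \<gamma> *\<^sub>R (A x1 + B y1 - b)) \<in> subdiff f x1" by (simp add: a_def)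
qed

lemma T_PRS_dual:
  fixes A :: "'a::{real_inner, complete_space} \<Rightarrow> 'g::real_inner"
    and B :: "'b::{real_inner, complete_space} \<Rightarrow> 'g"
  assumes "bounded_linear A" and "bounded_linear B" and "\<gamma> > 0"
    and "f x = ereal r" and "g y = ereal s"
    and "adjoint B w \<in> subdiff g y" and "adjoint A (w - \<gamma> *\<^sub>R (A x + B y - b)) \<in> subdiff f x"
    and z: "z = w + \<gamma> *\<^sub>R (B y - b)"
  shows "T_PRS \<gamma> (dual_f f A) (dual_g g B b) z = z - (2 * \<gamma>) *\<^sub>R (A x + B y - b)"
proof -
  have g: "prox \<gamma> (dual_g g B b) z = w"
    using prox_eqI[OF \<open>\<gamma> > 0\<close> dual_g_eq[OF assms(2,5,6)]] z by blast
  \<comment> \<open>The reflected point is the candidate for the second proximal point plus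
    \<open>\<gamma>\<close> times its dual subgradient; \<open>- 0\<close> matches the shift of
    \<open>dual_f\<close>.\<close>
  have "2 *\<^sub>R w - z = (w - \<gamma> *\<^sub>R (A x + B y - b)) + \<gamma> *\<^sub>R (A x - 0)"
    by (simp add: z scaleR_2 algebra_simps)
  from prox_eqI[OF \<open>\<gamma> > 0\<close> dual_g_eq[OF assms(1,4,7)] this]
  have f: "prox \<gamma> (dual_f f A) (2 *\<^sub>R w - z) = w - \<gamma> *\<^sub>R (A x + B y - b)"
    by (simp add: dual_f_eq_dual_g)
  have "T_PRS \<gamma> (dual_f f A) (dual_g g B b) z
      = 2 *\<^sub>R (w - \<gamma> *\<^sub>R (A x + B y - b)) - (2 *\<^sub>R w - z)"
    by (simp add: T_PRS_def refl_prox_def g f)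
  then show ?thesis
    by (simp add: z scaleR_2 mult_2 scaleR_left_distrib algebra_simps)
qed

section \<open>Averages, telescoping and fixed points\<close>

text \<open>Jensen's inequality, as a convex combination of the points \<open>(x i, F i)\<close> of
  the epigraph.\<close>

lemma ergodic_le:
  fixes f :: "'a::real_normed_vector \<Rightarrow> ereal"
  assumes "closed_proper_convex f" and "\<And>i. 0 < lam i" and "\<And>i. f (x i) = ereal (F i)"
  shows "f (ergodic lam x k) \<le> ereal ((\<Sum>i=0..k. lam i * F i) / cumulative lam k)"
proof -
  define L where "L = cumulative lam k"
  have L: "L > 0" unfolding L_def cumulative_def by (intro sum_pos assms) auto
  have "convex (epi f)" using assms(1) by (simp add: closed_proper_convex_def)
  then have "(\<Sum>i=0..k. (lam i / L) *\<^sub>R (x i, F i)) \<in> epi f"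
  proof (rule convex_sum[rotated])
    show "(\<Sum>i=0..k. lam i / L) = 1"
      using L by (simp add: L_def cumulative_def flip: sum_divide_distrib)
  qed (use L assms(2,3) in \<open>auto simp: epi_def less_imp_le\<close>)
  moreover have "(\<Sum>i=0..k. (lam i / L) *\<^sub>R (x i, F i))
      = (ergodic lam x k, (\<Sum>i=0..k. lam i * F i) / L)"
    by (simp add: prod_eq_iff fst_sum snd_sum ergodic_def scaleR_sum_right sum_divide_distrib
        flip: L_def)
  ultimately show ?thesis by (simp add: epi_def L_def)
qed

lemma sum_le_telescope:
  fixes a u :: "nat \<Rightarrow> real"
  assumes "\<And>i. a i \<le> u i - u (Suc i)"
  shows "(\<Sum>i=0..k. a i) \<le> u 0 - u (Suc k)"
proof (induction k)
  case (Suc k)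
  then show ?case using assms[of "Suc k"] by simp
qed (use assms in simp)

text \<open>Expanding the square produces \<open>l\<^sup>2\<close> in front of the residual term,
  and \<open>l \<le> 1\<close> bounds it by \<open>l\<close>. It serves two centres:
  \<open>zstar - wstar\<close> with \<open>E\<close> the gap, and \<open>zstar\<close> with
  \<open>E = 0\<close>.\<close>

lemma relaxed_step_norm:
  fixes s r :: "'g::real_inner"
  assumes "\<gamma> > 0" "0 < l" "l \<le> 1" and E: "E \<le> s \<bullet> r - \<gamma> * (norm r)\<^sup>2"
  shows "4 * \<gamma> * (l * E) \<le> (norm s)\<^sup>2 - (norm (s - (2 * \<gamma> * l) *\<^sub>R r))\<^sup>2"
proof -
  have "4 * \<gamma> * l * E \<le> 4 * \<gamma> * l * (s \<bullet> r - \<gamma> * (norm r)\<^sup>2)"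
    using E assms by (intro mult_left_mono) auto
  moreover have "4 * \<gamma>\<^sup>2 * l * l * (norm r)\<^sup>2 \<le> 4 * \<gamma>\<^sup>2 * l * 1 * (norm r)\<^sup>2"
    using assms by (intro mult_right_mono mult_left_mono) auto
  ultimately show ?thesis
    using norm_add_scaleR_squared[of s "- (2 * \<gamma> * l)" r]
    by (simp add: algebra_simps power2_eq_square)
qed

text \<open>At a fixed point the two reflections cancel, so both proximal points equal
  \<open>w\<close>; their optimality conditions give opposite subgradients.\<close>

lemma T_PRS_fixed_point_subdiff:
  fixes A :: "'a::{real_inner, complete_space} \<Rightarrow> 'g::{real_inner, complete_space}"
    and B :: "'b::{real_inner, complete_space} \<Rightarrow> 'g"
  assumes "bounded_linear A" and "bounded_linear B" and "\<gamma> > 0"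
    and "f x = ereal r" and "g y = ereal s"
    and "dual_f f A u \<noteq> \<infinity>" and "dual_g g B b v \<noteq> \<infinity>"
    and fix_z: "T_PRS \<gamma> (dual_f f A) (dual_g g B b) z = z"
    and w: "w = prox \<gamma> (dual_g g B b) z"
  shows "(1 / \<gamma>) *\<^sub>R (z - w) \<in> subdiff (dual_g g B b) w"
    and "- ((1 / \<gamma>) *\<^sub>R (z - w)) \<in> subdiff (dual_f f A) w"
proof -
  show "(1 / \<gamma>) *\<^sub>R (z - w) \<in> subdiff (dual_g g B b) w"
    unfolding w by (rule subdiff_prox_dual_g[where h = g, OF assms(2,5,7,3)])
  define v where "v = prox \<gamma> (dual_f f A) (2 *\<^sub>R w - z)"
  have "2 *\<^sub>R v - (2 *\<^sub>R w - z) = z"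
    using fix_z by (simp add: T_PRS_def refl_prox_def v_def flip: w)
  then have "2 *\<^sub>R v = 2 *\<^sub>R w" by (simp add: algebra_simps)
  then have v: "v = w" by simp
  have "(1 / \<gamma>) *\<^sub>R (2 *\<^sub>R w - z - v) \<in> subdiff (dual_f f A) v"
    unfolding v_def dual_f_eq_dual_g
    using assms(6)[unfolded dual_f_eq_dual_g]
    by (rule subdiff_prox_dual_g[where h = f, OF assms(1,4) _ assms(3)])
  moreover have "(1 / \<gamma>) *\<^sub>R (2 *\<^sub>R w - z - w) = - ((1 / \<gamma>) *\<^sub>R (z - w))"
    by (simp add: scaleR_2 algebra_simps)
  ultimately show "- ((1 / \<gamma>) *\<^sub>R (z - w)) \<in> subdiff (dual_f f A) w" by (simp add: v)
qed

theorem theorem14: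
  fixes f :: "'a::{real_inner, complete_space} \<Rightarrow> ereal"
    and g :: "'b::{real_inner, complete_space} \<Rightarrow> ereal"
    and A :: "'a \<Rightarrow> 'g::{real_inner, complete_space}"
    and B :: "'b \<Rightarrow> 'g"
    and b w_init zstar wstar :: 'g
    and \<gamma> :: real and lam :: "nat \<Rightarrow> real"
    and x :: "nat \<Rightarrow> 'a" and y :: "nat \<Rightarrow> 'b" and w z :: "nat \<Rightarrow> 'g"
    and xstar :: 'a and ystar :: 'b
  assumes "closed_proper_convex f" and "closed_proper_convex g"
    and "bounded_linear A" and "bounded_linear B"
    and "zer (\<lambda>v. subdiff (dual_f f A) v + subdiff (dual_g g B b) v) \<noteq> {}"
    and "\<And>v. subdiff (dual_f f A) v = A ` subdiff (convex_conjugate f) (adjoint A v)"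
    and "\<And>v. subdiff (dual_g g B b) v =
           (\<lambda>u. B u - b) ` subdiff (convex_conjugate g) (adjoint B v)"
    and "\<gamma> > 0" and "\<And>j. 0 < lam j \<and> lam j \<le> 1"
    and "relaxed_admm f g A B b \<gamma> lam w_init x y w"
    and "relaxed_prs \<gamma> (dual_f f A) (dual_g g B b) lam w_init z"
    and "T_PRS \<gamma> (dual_f f A) (dual_g g B b) zstar = zstar"
    and "wstar = prox \<gamma> (dual_g g B b) zstar"
    and "associated_primal_solution f g A B b wstar xstar ystar"
  shows "\<forall>k.
    ereal (- (2 * norm wstar * norm (z 0 - zstar)) / (\<gamma> * cumulative lam k))
      \<le> f (ergodic lam x k) + g (ergodic lam y k) - f xstar - g ystar \<and>
    f (ergodic lam x k) + g (ergodic lam y k) - f xstar - g ystar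
      \<le> ereal ((norm (z 0 - (zstar - wstar)))\<^sup>2 / (4 * \<gamma> * cumulative lam k))"

\<comment> \<open>The ergodic estimates\<close>
proof (intro allI)
  fix k
  note f = assms(1) and g = assms(2) and A = assms(3) and B = assms(4)
  interpret A: bounded_linear A by (rule A)
  interpret B: bounded_linear B by (rule B)
  have \<gamma>: "\<gamma> > 0" by (rule assms(8))
  have lam: "0 < lam i" "lam i \<le> 1" for i using assms(9) by auto
  define r where "r i = A (x i) + B (y i) - b" for i
  have step0: "admm_step f g A B b \<gamma> (1 / 2) (0, 0, w_init) (x 0, y 0, w 0)"
    and steps: "\<And>i. admm_step f g A B b \<gamma> (lam i) (x i, y i, w i)
      (x (Suc i), y (Suc i), w (Suc i))"
    using assms(10) unfolding relaxed_admm_def by blast+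
  \<comment> \<open>Index 0 comes from the starting step, every later index from a regular
    step.\<close>
  have subg: "adjoint B (w i) \<in> subdiff g (y i)" for i
    using admm_step_subdiff(1)[OF f g A B step0] admm_step_subdiff(1)[OF f g A B steps]
    by (cases i) blast+
  have subf: "adjoint A (w i - \<gamma> *\<^sub>R r i) \<in> subdiff f (x i)" for i
    unfolding r_def
    using admm_step_subdiff(2)[OF f g A B step0] admm_step_subdiff(2)[OF f g A B steps]
    by (cases i) blast+
  obtain F where F: "\<And>i. f (x i) = ereal (F i)" using subdiff_finite[OF f subf] by metis
  obtain G where G: "\<And>i. g (y i) = ereal (G i)" using subdiff_finite[OF g subg] by metis

  have z_eq: "z i = w i + \<gamma> *\<^sub>R (B (y i) - b)"
    and z_Suc: "z (Suc i) = z i - (2 * \<gamma> * lam i) *\<^sub>R r i" for i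
  proof -
    \<comment> \<open>The recursion is first shown conditionally, since evaluating
      \<open>T_PRS\<close> at \<open>z i\<close> needs the invariant that the induction below
      establishes.\<close>
    have next_z: "z (Suc i) = z i - (2 * \<gamma> * lam i) *\<^sub>R r i"
      if "z i = w i + \<gamma> *\<^sub>R (B (y i) - b)" for i
    proof -
      have "z (Suc i) = (1 - lam i) *\<^sub>R z i
          + lam i *\<^sub>R T_PRS \<gamma> (dual_f f A) (dual_g g B b) (z i)"
        using assms(11) by (simp add: relaxed_prs_def)
      then show ?thesis
        unfolding T_PRS_dual[where f = f and g = g, OF A B \<gamma> F G subg subf[unfolded r_def] that]
          r_def[symmetric]
        by (simp add: algebra_simps)
    qed
    show *: "z i = w i + \<gamma> *\<^sub>R (B (y i) - b)"
    proof (induction i)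
      case 0
      \<comment> \<open>The starting parameter 1/2 kills the relaxation term, and
        \<open>A 0 = 0\<close>.\<close>
      have "w 0 = w_init - \<gamma> *\<^sub>R (A 0 + B (y 0) - b)"
        using step0 by (simp add: admm_step_def)
      moreover have "z 0 = w_init" using assms(11) by (simp add: relaxed_prs_def)
      ultimately show ?case by (simp add: A.zero)
    next
      case (Suc i)
      have "w (Suc i) = w i - \<gamma> *\<^sub>R (A (x i) + B (y (Suc i)) - b)
          - (\<gamma> * (2 * lam i - 1)) *\<^sub>R r i"
        using steps[of i] unfolding admm_step_def r_def by blast
      then show ?case
        unfolding next_z[OF Suc] unfolding Suc r_def
        by (simp add: algebra_simps)
    qed
    show "z (Suc i) = z i - (2 * \<gamma> * lam i) *\<^sub>R r i" by (rule next_z[OF *])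
  qed

  have star: "A xstar + B ystar = b" and sfs: "adjoint A wstar \<in> subdiff f xstar"
    and sgs: "adjoint B wstar \<in> subdiff g ystar"
    using assms(14) by (auto simp: associated_primal_solution_def)
  obtain Fs Gs where Fs: "f xstar = ereal Fs" and Gs: "g ystar = ereal Gs"
    using subdiff_finite[OF f sfs] subdiff_finite[OF g sgs] by blast
  define p where "p = (1 / \<gamma>) *\<^sub>R (zstar - wstar)"
  have p: "\<gamma> *\<^sub>R p = zstar - wstar" using \<gamma> by (simp add: p_def)
  note df = dual_g_eq[where h = f and c = 0, OF A F subf, folded dual_f_eq_dual_g]
  note dg = dual_g_eq[where h = g and c = b, OF B G subg]
  note dfs = dual_g_eq(1)[where h = f and c = 0, OF A Fs sfs, folded dual_f_eq_dual_g]
  note dgs = dual_g_eq(1)[where h = g and c = b, OF B Gs sgs]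
  have "dual_f f A wstar \<noteq> \<infinity>" "dual_g g B b wstar \<noteq> \<infinity>" by (simp_all add: dfs dgs)
  note sp = T_PRS_fixed_point_subdiff[where f = f and g = g,
      OF A B \<gamma> Fs Gs this assms(12,13), folded p_def]
  define E where "E i = F i + G i - Fs - Gs" for i

  have gap: "E i \<le> (z i - (zstar - wstar)) \<bullet> r i - \<gamma> * (norm (r i))\<^sup>2"
    and monotone: "0 \<le> (z i - zstar) \<bullet> r i - \<gamma> * (norm (r i))\<^sup>2" for i
  proof -
    define a c where "a = A (x i)" and "c = B (y i) - b"
    have r: "r i = a + c" by (simp add: r_def a_def c_def)
    have z: "z i = w i + \<gamma> *\<^sub>R c" using z_eq by (simp add: c_def)
    have "(B ystar - b) \<bullet> wstar - Gs + (w i - wstar) \<bullet> p \<le> c \<bullet> w i - G i"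
      using subdiffD[OF sp(1), of "w i"] by (simp add: dg(1) dgs c_def)
    moreover have "A xstar \<bullet> wstar - Fs - (w i - \<gamma> *\<^sub>R r i - wstar) \<bullet> p
        \<le> a \<bullet> (w i - \<gamma> *\<^sub>R r i) - F i"
      using subdiffD[OF sp(2), of "w i - \<gamma> *\<^sub>R r i"] by (simp add: df(1) dfs a_def)
    \<comment> \<open>By feasibility the two dual values at \<open>wstar\<close> add up to
      \<open>- (Fs + Gs)\<close>.\<close>
    moreover have "A xstar \<bullet> wstar + (B ystar - b) \<bullet> wstar = 0"
      using star by (simp flip: inner_add_left add: add_diff_eq)
    ultimately have "E i \<le> c \<bullet> w i + a \<bullet> (w i - \<gamma> *\<^sub>R r i) - (\<gamma> *\<^sub>R r i) \<bullet> p"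
      by (simp add: E_def inner_diff_left)
    also have "\<dots> = (z i - \<gamma> *\<^sub>R p) \<bullet> r i - \<gamma> * (norm (r i))\<^sup>2"
      unfolding z r power2_norm_eq_inner
      by (simp add: inner_add_left inner_add_right inner_diff_left inner_diff_right
          inner_commute algebra_simps)
    finally show "E i \<le> (z i - (zstar - wstar)) \<bullet> r i - \<gamma> * (norm (r i))\<^sup>2" by (simp add: p)
    \<comment> \<open>Monotonicity of the subdifferential: the subgradient inequalities from both
      ends are added.\<close>
    have "0 \<le> (w i - wstar) \<bullet> (c - p)"
      using subdiffD[OF sp(1), of "w i"] subdiffD[OF dg(2), of i wstar]
      by (simp add: dg(1) dgs c_def inner_diff_left inner_diff_right)
    moreover have "0 \<le> (w i - \<gamma> *\<^sub>R r i - wstar) \<bullet> (a + p)"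
      using subdiffD[OF sp(2), of "w i - \<gamma> *\<^sub>R r i"] subdiffD[OF df(2), of i wstar]
      by (simp add: df(1) dfs a_def inner_diff_left inner_diff_right inner_add_right)
    ultimately have "0 \<le> (w i - wstar) \<bullet> (c - p) + (w i - \<gamma> *\<^sub>R r i - wstar) \<bullet> (a + p)"
      by simp
    also have "\<dots> = (z i - (wstar + \<gamma> *\<^sub>R p)) \<bullet> r i - \<gamma> * (norm (r i))\<^sup>2"
      unfolding z r power2_norm_eq_inner
      by (simp add: inner_add_left inner_add_right inner_diff_left inner_diff_right
          inner_commute algebra_simps)
    finally show "0 \<le> (z i - zstar) \<bullet> r i - \<gamma> * (norm (r i))\<^sup>2" by (simp add: p)
  qed

  have step_le: "4 * \<gamma> * (lam i * e) \<le> (norm (z i - s))\<^sup>2 - (norm (z (Suc i) - s))\<^sup>2"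
    if "e \<le> (z i - s) \<bullet> r i - \<gamma> * (norm (r i))\<^sup>2" for e s i
  proof -
    have "z (Suc i) - s = (z i - s) - (2 * \<gamma> * lam i) *\<^sub>R r i" using z_Suc by simp
    then show ?thesis using relaxed_step_norm[OF \<gamma> lam that, of i] by (simp only:)
  qed
  have sum_E: "(\<Sum>i=0..k. 4 * \<gamma> * (lam i * E i)) \<le> (norm (z 0 - (zstar - wstar)))\<^sup>2"
  proof -
    have "(\<Sum>i=0..k. 4 * \<gamma> * (lam i * E i))
        \<le> (norm (z 0 - (zstar - wstar)))\<^sup>2 - (norm (z (Suc k) - (zstar - wstar)))\<^sup>2"
      by (rule sum_le_telescope[where u = "\<lambda>i. (norm (z i - (zstar - wstar)))\<^sup>2"])
        (rule step_le[OF gap])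
    also have "\<dots> \<le> (norm (z 0 - (zstar - wstar)))\<^sup>2" by simp
    finally show ?thesis .
  qed
  have fejer: "norm (z (Suc k) - zstar) \<le> norm (z 0 - zstar)"
  proof -
    have "(\<Sum>i=0..k. 4 * \<gamma> * (lam i * 0))
        \<le> (norm (z 0 - zstar))\<^sup>2 - (norm (z (Suc k) - zstar))\<^sup>2"
      by (rule sum_le_telescope[where u = "\<lambda>i. (norm (z i - zstar))\<^sup>2"])
        (rule step_le[OF monotone])
    then have "(norm (z (Suc k) - zstar))\<^sup>2 \<le> (norm (z 0 - zstar))\<^sup>2" by simp
    then show ?thesis by (rule power2_le_imp_le) simp
  qed

  define L where "L = cumulative lam k"
  have L: "L > 0" unfolding L_def cumulative_def by (intro sum_pos lam) auto
  define xk yk where "xk = ergodic lam x k" and "yk = ergodic lam y k"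
  have fx: "f xk \<le> ereal ((\<Sum>i=0..k. lam i * F i) / L)"
    and gy: "g yk \<le> ereal ((\<Sum>i=0..k. lam i * G i) / L)"
    unfolding xk_def yk_def L_def
    using ergodic_le[where f = f, OF f lam(1) F] ergodic_le[where f = g, OF g lam(1) G] by auto
  \<comment> \<open>Besides giving the lower estimate, these bounds and the Jensen bounds make both
    values at the averages finite.\<close>
  have fx': "ereal (Fs + A (xk - xstar) \<bullet> wstar) \<le> f xk"
    using subdiffD[OF sfs, of xk] by (simp add: Fs inner_adjoint[OF A])
  have gy': "ereal (Gs + B (yk - ystar) \<bullet> wstar) \<le> g yk"
    using subdiffD[OF sgs, of yk] by (simp add: Gs inner_adjoint[OF B])
  obtain fr gr where fr: "f xk = ereal fr" and gr: "g yk = ereal gr"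
    using fx fx' gy gy' by (cases "f xk"; cases "g yk") auto

  \<comment> \<open>Writing the optimal value over \<open>L\<close> turns the right side into the
    weighted average of the gaps \<open>E i\<close>.\<close>
  have "fr + gr - Fs - Gs
      \<le> (\<Sum>i=0..k. lam i * F i) / L + (\<Sum>i=0..k. lam i * G i) / L - (Fs + Gs) * L / L"
    using fx gy L by (simp add: fr gr)
  also have "\<dots> = (\<Sum>i=0..k. lam i * E i) / L"
    by (simp add: E_def L_def cumulative_def sum_distrib_left sum.distrib sum_subtractf
        algebra_simps diff_divide_distrib add_divide_distrib)
  also have "\<dots> = (\<Sum>i=0..k. 4 * \<gamma> * (lam i * E i)) / (4 * \<gamma> * L)"
    using \<gamma> by (simp flip: sum_distrib_left)
  also have "\<dots> \<le> (norm (z 0 - (zstar - wstar)))\<^sup>2 / (4 * \<gamma> * L)"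
    using sum_E \<gamma> L by (intro divide_right_mono) auto
  finally have upper: "fr + gr - Fs - Gs \<le> (norm (z 0 - (zstar - wstar)))\<^sup>2 / (4 * \<gamma> * L)" .

  \<comment> \<open>Unrolling the recursion expresses the residual of the averages through the total
    displacement of \<open>z\<close>.\<close>
  have "z (Suc k) = z 0 - (2 * \<gamma>) *\<^sub>R (\<Sum>i=0..k. lam i *\<^sub>R r i)"
    by (induction k) (simp_all add: z_Suc algebra_simps)
  moreover have "(\<Sum>i=0..k. lam i *\<^sub>R r i) = L *\<^sub>R (A xk + B yk - b)"
  proof -
    have "L *\<^sub>R xk = (\<Sum>i=0..k. lam i *\<^sub>R x i)" "L *\<^sub>R yk = (\<Sum>i=0..k. lam i *\<^sub>R y i)"
      using L by (simp_all add: xk_def yk_def ergodic_def flip: L_def)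
    then have "L *\<^sub>R A xk = (\<Sum>i=0..k. lam i *\<^sub>R A (x i))"
        "L *\<^sub>R B yk = (\<Sum>i=0..k. lam i *\<^sub>R B (y i))"
      by (simp_all add: A.sum A.scaleR B.sum B.scaleR flip: A.scaleR B.scaleR)
    moreover have "L *\<^sub>R b = (\<Sum>i=0..k. lam i *\<^sub>R b)"
      by (simp add: L_def cumulative_def scaleR_sum_left)
    ultimately show ?thesis
      by (simp add: r_def scaleR_add_right scaleR_diff_right sum.distrib sum_subtractf)
  qed
  ultimately have res: "(2 * \<gamma> * L) *\<^sub>R (A xk + B yk - b) = z 0 - z (Suc k)" by simp
  have "- (2 * norm (z 0 - zstar) * norm wstar) \<le> (z 0 - z (Suc k)) \<bullet> wstar"
  proof -
    \<comment> \<open>Passing through \<open>zstar\<close> and using Fejer monotonicity produces the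
      factor 2.\<close>
    have "norm (z 0 - z (Suc k)) \<le> norm (z 0 - zstar) + norm (z (Suc k) - zstar)"
      using norm_triangle_ineq4[of "z 0 - zstar" "z (Suc k) - zstar"] by simp
    also have "\<dots> \<le> 2 * norm (z 0 - zstar)" using fejer by simp
    finally have "norm (z 0 - z (Suc k)) * norm wstar \<le> 2 * norm (z 0 - zstar) * norm wstar"
      by (rule mult_right_mono) simp
    then show ?thesis using Cauchy_Schwarz_ineq2[of "z 0 - z (Suc k)" wstar] by linarith
  qed
  also have "\<dots> = 2 * \<gamma> * L * ((A xk + B yk - b) \<bullet> wstar)"
    by (simp flip: res)
  also have "(A xk + B yk - b) \<bullet> wstar = A (xk - xstar) \<bullet> wstar + B (yk - ystar) \<bullet> wstar"
    by (simp add: A.diff B.diff inner_add_left inner_diff_left flip: star)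
  also have "2 * \<gamma> * L * \<dots> \<le> 2 * \<gamma> * L * (fr + gr - Fs - Gs)"
    using fx' gy' \<gamma> L by (intro mult_left_mono) (auto simp: fr gr)
  finally have "- (norm wstar * norm (z 0 - zstar)) \<le> (fr + gr - Fs - Gs) * (\<gamma> * L)"
    by (simp add: algebra_simps)
  \<comment> \<open>The estimate so far has half the stated constant; nonnegativity of the product
    relaxes it to the stated one.\<close>
  moreover have "0 \<le> norm wstar * norm (z 0 - zstar)" by simp
  ultimately have "- (2 * norm wstar * norm (z 0 - zstar)) \<le> (fr + gr - Fs - Gs) * (\<gamma> * L)"
    by linarith
  then have lower: "- (2 * norm wstar * norm (z 0 - zstar)) / (\<gamma> * L) \<le> fr + gr - Fs - Gs"
    using pos_divide_le_eq[OF mult_pos_pos[OF \<gamma> L]] by blast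
  from lower upper show "ereal (- (2 * norm wstar * norm (z 0 - zstar)) / (\<gamma> * cumulative lam k))
      \<le> f (ergodic lam x k) + g (ergodic lam y k) - f xstar - g ystar \<and>
    f (ergodic lam x k) + g (ergodic lam y k) - f xstar - g ystar
      \<le> ereal ((norm (z 0 - (zstar - wstar)))\<^sup>2 / (4 * \<gamma> * cumulative lam k))"
    unfolding L_def[symmetric] xk_def[symmetric] yk_def[symmetric] fr gr Fs Gs by simp
qed

end
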